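(* Let $A\in\mathbb{R}^{m\times m}$, $B\in\mathbb{R}^{m\times l}$, $K\in\mathbb{R}^{l\times m}$ with $A+BK$ Hurwitz, let $P\in\mathbb{R}^{m\times m}$ be symmetric positive definite and $\lambda_o>0$ such that $V(x)=(x^TPx)^{1/2}$ is a Lyapunov function for $\dot\xi=(A+BK)\xi$ with rate of decay $\lambda_o$, and let $0<\lambda<\lambda_o$. Let $\Delta,\tau_{\min},\tau_{\max}>0$, and let $\Gamma_d$, $\Gamma_c$ be the maps defined in the context. Put $\tau^*(x):=\min\{\Gamma_c(x),\tau_{\max}\}$. Then $$\Gamma_d(x)\ \ge\ \tau^*(x)-\Delta\qquad\text{for all }x\in\mathbb{R}^m.$$
   Context: "$V(x)=(x^TPx)^{1/2}$ is a Lyapunov function for $\dot\xi=(A+BK)\xi$ with rate of decay $\lambda_o$" means $\frac{\partial V}{\partial x}(A+BK)x\le-\lambda_oV(x)$ for $x\ne0$, equivalently $(A+BK)^TP+P(A+BK)\le-2\lambda_oP$. $\mathbb{N}$ includes $0$. For $x\in\mathbb{R}^m$ let $\xi_x$ be the solution of $\dot\xi_x(t)=A\xi_x(t)+BKx$, $\xi_x(0)=x$ (disturbance-free system with input held constant at $Kx$). Define $h_c(x,t):=V(\xi_x(t))-V(x)e^{-\lambda t}$ for $t\ge0$, $h_d(x,n):=h_c(x,n\Delta)$ for $n\in\mathbb{N}$, and $N_{\max}:=\lfloor\tau_{\max}/\Delta\rfloor$. Then $$\Gamma_d(x):=\max\{\tau_{\min},\,n(x)\Delta\},\qquad n(x):=\max\{n\in\mathbb{N}: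 n\le N_{\max},\ h_d(x,s)\le0\text{ for }s=0,\dots,n\},$$ $$\Gamma_c(x):=\max\{\tau\ge0:\ \tau\le\tau_{\max},\ h_c(x,s)\le0\text{ for all }s\in[0,\tau]\}.$$ *)

theory Defs
  imports "HOL-Analysis.Analysis"
begin

definition hurwitz :: "real^'n^'n \<Rightarrow> bool" where
  "hurwitz M \<longleftrightarrow>
     (\<forall>(\<mu>::complex) (v::complex^'n).
        v \<noteq> 0 \<and> map_matrix complex_of_real M *v v = \<mu> *s v \<longrightarrow> Re \<mu> < 0)"

definition sym_pos_def :: "real^'n^'n \<Rightarrow> bool" where
  "sym_pos_def P \<longleftrightarrow> transpose P = P \<and> (\<forall>x. x \<noteq> 0 \<longrightarrow> x \<bullet> (P *v x) > 0)"

definition V_fun :: "real^'m^'m \<Rightarrow> real^'m \<Rightarrow> real" where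
  "V_fun P x = sqrt (x \<bullet> (P *v x))"

(* The derivative of V at x, applied to f x, is the product of the row vector dV/dx with f x.
   The origin is excluded since a quadratic-form norm is not differentiable there. *)
definition lyapunov_decay ::
    "(real^'m \<Rightarrow> real) \<Rightarrow> (real^'m \<Rightarrow> real^'m) \<Rightarrow> real \<Rightarrow> bool" where
  "lyapunov_decay V f r \<longleftrightarrow>
     (\<forall>x. x \<noteq> 0 \<longrightarrow> (\<exists>V'. (V has_derivative V') (at x) \<and> V' (f x) \<le> - r * V x))"

definition held_solution ::
    "real^'m^'m \<Rightarrow> real^'l^'m \<Rightarrow> real^'m^'l \<Rightarrow> real^'m \<Rightarrow> (real \<Rightarrow> real^'m) \<Rightarrow> bool" where
  "held_solution A B K x \<xi> \<longleftrightarrow>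
     \<xi> 0 = x \<and>
     (\<forall>t\<ge>0. (\<xi> has_vector_derivative (A *v \<xi> t + B *v (K *v x))) (at t within {0..}))"

(* In the definitions below, \<xi> x is the trajectory \<xi>_x; only its values at times t \<ge> 0 matter. *)

definition h_c ::
    "real^'m^'m \<Rightarrow> (real^'m \<Rightarrow> real \<Rightarrow> real^'m) \<Rightarrow> real \<Rightarrow> real^'m \<Rightarrow> real \<Rightarrow> real" where
  "h_c P \<xi> lam x t = V_fun P (\<xi> x t) - V_fun P x * exp (- lam * t)"

definition h_d ::
    "real^'m^'m \<Rightarrow> (real^'m \<Rightarrow> real \<Rightarrow> real^'m) \<Rightarrow> real \<Rightarrow> real \<Rightarrow> real^'m \<Rightarrow> nat \<Rightarrow> real" where
  "h_d P \<xi> lam \<Delta> x n = h_c P \<xi> lam x (real n * \<Delta>)"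

definition N_max :: "real \<Rightarrow> real \<Rightarrow> nat" where
  "N_max \<Delta> \<tau>max = nat \<lfloor>\<tau>max / \<Delta>\<rfloor>"

definition n_trigger ::
    "real^'m^'m \<Rightarrow> (real^'m \<Rightarrow> real \<Rightarrow> real^'m) \<Rightarrow> real \<Rightarrow> real \<Rightarrow> real \<Rightarrow> real^'m \<Rightarrow> nat" where
  "n_trigger P \<xi> lam \<Delta> \<tau>max x =
     (GREATEST n. n \<le> N_max \<Delta> \<tau>max \<and> (\<forall>s\<in>{0..n}. h_d P \<xi> lam \<Delta> x s \<le> 0))"

definition Gamma_d ::
    "real^'m^'m \<Rightarrow> (real^'m \<Rightarrow> real \<Rightarrow> real^'m) \<Rightarrow> real \<Rightarrow> real \<Rightarrow> real \<Rightarrow> real \<Rightarrow> real^'m \<Rightarrow> real" where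
  "Gamma_d P \<xi> lam \<Delta> \<tau>min \<tau>max x = max \<tau>min (real (n_trigger P \<xi> lam \<Delta> \<tau>max x) * \<Delta>)"

(* GREATEST is the maximum of a possibly infinite set; Max is only meaningful for finite sets. *)
definition Gamma_c ::
    "real^'m^'m \<Rightarrow> (real^'m \<Rightarrow> real \<Rightarrow> real^'m) \<Rightarrow> real \<Rightarrow> real \<Rightarrow> real^'m \<Rightarrow> real" where
  "Gamma_c P \<xi> lam \<tau>max x =
     (GREATEST \<tau>. \<tau> \<ge> 0 \<and> \<tau> \<le> \<tau>max \<and> (\<forall>s\<in>{0..\<tau>}. h_c P \<xi> lam x s \<le> 0))"

definition tau_star ::
    "real^'m^'m \<Rightarrow> (real^'m \<Rightarrow> real \<Rightarrow> real^'m) \<Rightarrow> real \<Rightarrow> real \<Rightarrow> real^'m \<Rightarrow> real" where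
  "tau_star P \<xi> lam \<tau>max x = min (Gamma_c P \<xi> lam \<tau>max x) \<tau>max"

end

theory Submission
  imports Defs
begin

text \<open>
  Write \<open>c\<close> for the value of \<open>Gamma_c\<close> at \<open>x\<close>. Since \<open>h_c\<close> is nonpositive on all of
  \<open>[0, c]\<close>, it is nonpositive at every sampling time \<open>s \<Delta> \<le> c\<close>, so the sampled trigger passes
  all the tests up to \<open>\<lfloor>c / \<Delta>\<rfloor>\<close>; and \<open>\<lfloor>c / \<Delta>\<rfloor> \<Delta>\<close> misses \<open>c\<close> by less than one sampling period.

  The point needing care is that the maximum defining \<open>Gamma_c\<close> is attained: otherwise its value
  would carry no information at all. It is attained because \<open>h_c\<close> is continuous in time, which
  makes the set of admissible horizons closed (\<open>Greatest_nonpos_horizon\<close>), and because this set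
  contains \<open>0\<close>, where \<open>h_c\<close> vanishes.
\<close>

text \<open>
  The supremum of the admissible horizons is itself admissible: below it the inequality holds on a
  half-open interval, and continuity carries it to the right endpoint. The case where the supremum
  is \<open>0\<close> is separate, because the half-open interval is then empty.
\<close>

lemma Greatest_nonpos_horizon:
  fixes f :: "real \<Rightarrow> real"
  assumes cont: "continuous_on {0..b} f" and f0: "f 0 \<le> 0" and b: "0 \<le> b"
  defines "G \<equiv> (GREATEST t. 0 \<le> t \<and> t \<le> b \<and> (\<forall>s\<in>{0..t}. f s \<le> 0))"
  shows "0 \<le> G \<and> G \<le> b \<and> (\<forall>s\<in>{0..G}. f s \<le> 0)"
proof -
  define T where "T = {t. 0 \<le> t \<and> t \<le> b \<and> (\<forall>s\<in>{0..t}. f s \<le> 0)}"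
  define c where "c = Sup T"
  have zero: "0 \<in> T"
    using f0 b by (auto simp: T_def)
  have bdd: "bdd_above T"
    unfolding T_def by (rule bdd_aboveI[of _ b]) auto
  have upper: "t \<le> c" if "t \<in> T" for t
    unfolding c_def using that bdd by (rule cSup_upper)
  have c0: "0 \<le> c"
    using upper zero by blast
  have cb: "c \<le> b"
    unfolding c_def using zero by (intro cSup_least) (auto simp: T_def)
  have below: "f s \<le> 0" if s: "0 \<le> s" "s < c" for s
  proof -
    obtain t where "t \<in> T" "s < t"
      using s(2) less_cSup_iff[OF _ bdd, of s] zero unfolding c_def by blast
    then show ?thesis
      using s(1) by (auto simp: T_def)
  qed
  have upto: "f s \<le> 0" if "s \<in> {0..c}" for s
  proof (cases "c = 0")
    case True
    then show ?thesis
      using that f0 by auto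
  next
    case False
    then have closure: "closure {0..<c} = {0..c}"
      using c0 by simp
    have "continuous_on (closure {0..<c}) f"
      unfolding closure by (rule continuous_on_subset[OF cont]) (use cb in auto)
    then show ?thesis
    proof (rule continuous_le_on_closure)
      show "s \<in> closure {0..<c}"
        using that closure by simp
      show "f u \<le> 0" if "u \<in> {0..<c}" for u
        using that below by simp
    qed
  qed
  have "G = c"
    unfolding G_def
  proof (rule Greatest_equality)
    show "0 \<le> c \<and> c \<le> b \<and> (\<forall>s\<in>{0..c}. f s \<le> 0)"
      using c0 cb upto by blast
    show "t \<le> c" if "0 \<le> t \<and> t \<le> b \<and> (\<forall>s\<in>{0..t}. f s \<le> 0)" for t
      using that by (intro upper) (simp add: T_def)
  qed
  then show ?thesis
    using c0 cb upto by blast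
qed

lemma continuous_on_V_fun: "continuous_on S (V_fun P)"
  unfolding V_fun_def
  by (intro continuous_intros matrix_vector_mult_linear_continuous_on)

lemma held_solution_continuous_on:
  assumes "held_solution A B K x \<xi>"
  shows "continuous_on {0..} \<xi>"
  using assms unfolding held_solution_def
  by (intro continuous_on_vector_derivative) auto

lemma continuous_on_h_c:
  assumes "held_solution A B K x (\<xi> x)"
  shows "continuous_on {0..} (h_c P \<xi> lam x)"
  unfolding h_c_def
  by (intro continuous_intros held_solution_continuous_on[OF assms]
      continuous_on_compose2[OF continuous_on_V_fun[of UNIV]]) auto

text \<open>
  The bound \<open>N_max\<close> on the number of samples guarantees that the maximum defining \<open>n_trigger\<close>
  exists, so that every number of passed tests is below it.
\<close>

lemma le_n_trigger:
  assumes "n \<le> N_max \<Delta> \<tau>max" and "\<And>s. s \<le> n \<Longrightarrow> h_d P \<xi> lam \<Delta> x s \<le> 0"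
  shows "n \<le> n_trigger P \<xi> lam \<Delta> \<tau>max x"
  unfolding n_trigger_def
  using assms by (intro Greatest_le_nat[where b = "N_max \<Delta> \<tau>max"]) auto

theorem proposition4p3:
  fixes A :: "real^'m^'m" and B :: "real^'l^'m" and K :: "real^'m^'l"
    and P :: "real^'m^'m"
    and lam_o lam \<Delta> \<tau>min \<tau>max :: real
    and \<xi> :: "real^'m \<Rightarrow> real \<Rightarrow> real^'m"
  assumes "hurwitz (A + B ** K)"
    and "sym_pos_def P"
    and "lam_o > 0"
    and "lyapunov_decay (V_fun P) (\<lambda>x. (A + B ** K) *v x) lam_o"
    and "0 < lam" and "lam < lam_o"
    and "\<Delta> > 0" and "\<tau>min > 0" and "\<tau>max > 0"
    and "\<And>x. held_solution A B K x (\<xi> x)"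
  shows "\<forall>x. Gamma_d P \<xi> lam \<Delta> \<tau>min \<tau>max x \<ge> tau_star P \<xi> lam \<tau>max x - \<Delta>"
proof
  fix x
  define c where "c = Gamma_c P \<xi> lam \<tau>max x"
  define n where "n = nat \<lfloor>c / \<Delta>\<rfloor>"
  have sol: "held_solution A B K x (\<xi> x)"
    by fact
  have "continuous_on {0..\<tau>max} (h_c P \<xi> lam x)"
    using continuous_on_h_c[where \<xi> = \<xi>, OF sol] by (rule continuous_on_subset) auto
  moreover have "h_c P \<xi> lam x 0 \<le> 0"
    using sol by (simp add: h_c_def held_solution_def)
  ultimately have "0 \<le> c \<and> c \<le> \<tau>max \<and> (\<forall>s\<in>{0..c}. h_c P \<xi> lam x s \<le> 0)"
    unfolding c_def Gamma_c_def using \<open>\<tau>max > 0\<close>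
    by (intro Greatest_nonpos_horizon) auto
  then have c: "0 \<le> c" "c \<le> \<tau>max" "\<And>s. s \<in> {0..c} \<Longrightarrow> h_c P \<xi> lam x s \<le> 0"
    by blast+
  have "0 \<le> \<lfloor>c / \<Delta>\<rfloor>"
    using c(1) \<open>\<Delta> > 0\<close> by simp
  then have "real n = of_int \<lfloor>c / \<Delta>\<rfloor>"
    unfolding n_def by simp
  then have n_le: "real n \<le> c / \<Delta>" and n_gt: "c / \<Delta> < real n + 1"
    by linarith+
  have "n \<le> n_trigger P \<xi> lam \<Delta> \<tau>max x"
  proof (rule le_n_trigger)
    show "n \<le> N_max \<Delta> \<tau>max"
      unfolding n_def N_max_def using c(2) \<open>\<Delta> > 0\<close>
      by (intro nat_mono floor_mono divide_right_mono) auto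
    fix s assume "s \<le> n"
    then have "real s \<le> c / \<Delta>"
      using n_le by linarith
    then have "real s * \<Delta> \<le> c"
      using \<open>\<Delta> > 0\<close> by (simp add: field_simps)
    then show "h_d P \<xi> lam \<Delta> x s \<le> 0"
      unfolding h_d_def using c(3) \<open>\<Delta> > 0\<close> by simp
  qed
  then have "real n * \<Delta> \<le> Gamma_d P \<xi> lam \<Delta> \<tau>min \<tau>max x"
    unfolding Gamma_d_def using \<open>\<Delta> > 0\<close> by (simp add: max.coboundedI2)
  moreover have "c - \<Delta> < real n * \<Delta>"
    using n_gt \<open>\<Delta> > 0\<close> by (simp add: field_simps)
  moreover have "tau_star P \<xi> lam \<tau>max x \<le> c"
    unfolding tau_star_def c_def by simp
  ultimately show "tau_star P \<xi> lam \<tau>max x - \<Delta> \<le> Gamma_d P \<xi> lam \<Delta> \<tau>min \<tau>max x"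
    by linarith
qed

end
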